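(* Let $p>3$ be a prime and let $a\in\mathbb Z_p$ with $a\not\equiv 0,-1\pmod p$. Put $t=(a-\langle a\rangle_p)/p$. Then $$\sum_{k=0}^{p-1}k\binom ak\binom{-1-a}k\equiv (-1)^{\langle a\rangle_p}a(a+1)+p^2t(t+1)\big(a(a+1)E_{p-3}(-a)-1\big)\pmod{p^3}.$$
   Context: $\mathbb Z_p$ denotes the set of rational numbers whose denominator is not divisible by $p$. For $x,y\in\mathbb Q$, $x\equiv y\pmod{p^m}$ means $(x-y)/p^m\in\mathbb Z_p$. For $a\in\mathbb Z_p$, $\langle a\rangle_p\in\{0,1,\ldots,p-1\}$ is defined by $a\equiv\langle a\rangle_p\pmod p$. For rational $a$ and integer $k\ge0$, $\binom ak=a(a-1)\cdots(a-k+1)/k!$. The Euler numbers are defined by $E_0=1$, $E_n=-\sum_{k=1}^{[n/2]}\binom n{2k}E_{n-2k}$ for $n\ge1$, and the Euler polynomials by $E_n(x)=\frac1{2^n}\sum_{k=0}^n\binom nk(2x-1)^{n-k}E_k$. *)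

theory Defs
  imports Complex_Main "HOL-Computational_Algebra.Primes"
begin

text \<open>The ring of rationals whose (reduced) denominator is not divisible by \<open>p\<close>.\<close>

definition Zp :: "nat \<Rightarrow> rat set" where
  "Zp p = {x. \<not> int p dvd snd (quotient_of x)}"

definition rat_cong :: "nat \<Rightarrow> nat \<Rightarrow> rat \<Rightarrow> rat \<Rightarrow> bool" where
  "rat_cong p m x y \<longleftrightarrow> (x - y) / of_nat p ^ m \<in> Zp p"

text \<open>The definite description is only meaningful for prime \<open>p\<close> and \<open>a \<in> Zp p\<close>,
  where \<open>residue_ex1\<close> below shows that it is well-defined.\<close>

definition residue :: "nat \<Rightarrow> rat \<Rightarrow> nat" where
  "residue p a = (THE r. r < p \<and> rat_cong p 1 a (of_nat r))"

fun euler_number :: "nat \<Rightarrow> int" where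
  "euler_number n =
     (if n = 0 then 1
      else - (\<Sum>k = 1..n div 2. int (n choose (2 * k)) * euler_number (n - 2 * k)))"

declare euler_number.simps [simp del]

definition euler_poly :: "nat \<Rightarrow> rat \<Rightarrow> rat" where
  "euler_poly n x =
     1 / 2 ^ n * (\<Sum>k\<le>n. of_nat (n choose k) * (2 * x - 1) ^ (n - k) * of_int (euler_number k))"

lemma Zp_iff:
  assumes "prime p"
  shows "x \<in> Zp p \<longleftrightarrow> (\<exists>n d. \<not> int p dvd d \<and> x = of_int n / of_int d)"
proof
  obtain n d where q: "quotient_of x = (n, d)" by fastforce
  have x: "x = of_int n / of_int d" using q quotient_of_div by blast
  {
    assume "x \<in> Zp p"
    then show "\<exists>n d. \<not> int p dvd d \<and> x = of_int n / of_int d"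
      using q x by (auto simp: Zp_def)
  next
    assume "\<exists>n d. \<not> int p dvd d \<and> x = of_int n / of_int d"
    then obtain n' d' where d': "\<not> int p dvd d'" and x': "x = of_int n' / of_int d'" by blast
    have "d' \<noteq> 0" using d' by auto
    moreover have "d \<noteq> 0" using q quotient_of_denom_pos by blast
    ultimately have "(of_int (n * d') :: rat) = of_int (n' * d)"
      using x x' by (simp add: field_simps)
    then have "n * d' = n' * d" using of_int_eq_iff by blast
    then have "d dvd n * d'" by simp
    moreover have "coprime d n" using quotient_of_coprime[OF q] by (simp add: coprime_commute)
    ultimately have "d dvd d'" by (simp add: coprime_dvd_mult_right_iff)
    then show "x \<in> Zp p" using d' q by (auto simp: Zp_def intro: dvd_trans)
  }
qed

lemma Zp_div_iff:
  assumes p: "prime p" and d: "\<not> int p dvd d"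
  shows "(of_int z / of_int d :: rat) / of_nat p \<in> Zp p \<longleftrightarrow> int p dvd z"
proof
  have d0: "d \<noteq> 0" using d by auto
  have p0: "p > 0" using p prime_gt_0_nat by blast
  {
    assume "int p dvd z"
    then obtain k where "z = int p * k" by (auto elim: dvdE)
    then have "(of_int z / of_int d :: rat) / of_nat p = of_int k / of_int d"
      using p0 by simp
    then show "(of_int z / of_int d :: rat) / of_nat p \<in> Zp p" using Zp_iff[OF p] d by blast
  next
    assume "(of_int z / of_int d :: rat) / of_nat p \<in> Zp p"
    then obtain n e where e: "\<not> int p dvd e"
      and "(of_int z / of_int d :: rat) / of_nat p = of_int n / of_int e"
      using Zp_iff[OF p] by blast
    moreover have "e \<noteq> 0" using e by auto
    ultimately have "(of_int (z * e) :: rat) = of_int (n * d * int p)"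
      using d0 p0 by (simp add: field_simps)
    then have "z * e = n * d * int p" using of_int_eq_iff by blast
    then have "int p dvd z * e" by simp
    then show "int p dvd z" using e p prime_dvd_mult_iff[of "int p"] by simp
  }
qed

lemma residue_ex1:
  assumes p: "prime p" and a: "a \<in> Zp p"
  shows "\<exists>!r. r < p \<and> rat_cong p 1 a (of_nat r)"
proof -
  obtain n d where d: "\<not> int p dvd d" and a_eq: "a = of_int n / of_int d"
    using Zp_iff[OF p] a by blast
  have d0: "d \<noteq> 0" using d by auto
  have iff: "rat_cong p 1 a (of_nat r) \<longleftrightarrow> int p dvd n - int r * d" for r
  proof -
    have "a - of_nat r = of_int (n - int r * d) / of_int d"
      using d0 by (simp add: a_eq field_simps)
    then show ?thesis using Zp_div_iff[OF p d, of "n - int r * d"] by (simp add: rat_cong_def)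
  qed
  have "coprime (int p) d" using p d by (simp add: prime_imp_coprime)
  then obtain u v where uv: "u * int p + v * d = 1"
    using bezout_int[of "int p" d] by auto
  define r where "r = nat ((v * n) mod int p)"
  have p0: "int p > 0" using p prime_gt_0_nat by simp
  have r: "int r = (v * n) mod int p" using p0 by (simp add: r_def)
  have "int r < int p" unfolding r using p0 by simp
  then have "r < p" by simp
  moreover have "int p dvd n - int r * d"
  proof -
    have "n - int r * d = n * (u * int p + v * d) - int r * d" using uv by simp
    also have "\<dots> = int p * (n * u) + (v * n - int r) * d" by (simp add: algebra_simps)
    finally show ?thesis using r by (simp add: mod_eq_dvd_iff [symmetric] dvd_minus_mod)
  qed
  moreover have "s = s'" if "s < p" "s' < p" "int p dvd n - int s * d" "int p dvd n - int s' * d" for s s'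
  proof -
    have "int p dvd (n - int s * d) - (n - int s' * d)" using that dvd_diff by blast
    then have "int p dvd (int s' - int s) * d" by (simp add: algebra_simps)
    then have "int p dvd int s' - int s" using d p prime_dvd_mult_iff[of "int p"] by simp
    then have "int s' mod int p = int s mod int p" by (simp add: mod_eq_dvd_iff)
    then show ?thesis using that by simp
  qed
  ultimately show ?thesis unfolding iff by blast
qed

end

theory Submission
  imports Defs "HOL-Number_Theory.Residues"
begin

text \<open>
  With \<open>u\<^sub>k = (a gchoose k) * ((-1 - a) gchoose k)\<close> one has
  \<open>(k + 1)\<^sup>2 u\<^bsub>k+1\<^esub> - k\<^sup>2 u\<^sub>k = (k - a(a + 1)) u\<^sub>k\<close>, so telescoping reduces the weighted sum
  to \<open>S(a) = (\<Sum>k<p. u\<^sub>k)\<close> and the boundary term \<open>p\<^sup>2 u\<^sub>p \<equiv> -p\<^sup>2 t(t + 1)\<close>. The sum \<open>S(a) + S(a - 1)\<close>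
  is in closed form and congruent to \<open>2p\<^sup>2 t(t + 1) / a\<^sup>2\<close> if \<open>p\<close> does not divide \<open>a\<close>; since
  \<open>E\<^bsub>p-3\<^esub>(-a) + E\<^bsub>p-3\<^esub>(1 - a) = 2(-a)\<^bsup>p-3\<^esup> \<equiv> 2 / a\<^sup>2\<close>, induction on the residue of \<open>a\<close> reduces
  \<open>S(a) \<equiv> (-1)\<^bsup>r\<^esup> + p\<^sup>2 t(t + 1) E\<^bsub>p-3\<^esub>(-a)\<close> to the case \<open>a = pt\<close>, which is Wolstenholme's theorem
  together with \<open>E\<^bsub>p-3\<^esub>(0) = 0\<close>.
\<close>

section \<open>Euler polynomials\<close>

lemma euler_number_odd:
  assumes "odd n"
  shows "euler_number n = 0"
  using assms
proof (induction n rule: less_induct)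
  case (less n)
  have "euler_number (n - 2 * k) = 0" if "k \<in> {1..n div 2}" for k
    using less that by auto
  then show ?case
    using less.prems by (subst euler_number.simps) (auto simp: odd_pos)
qed

lemma sum_euler_number_even:
  "(\<Sum>k\<le>m. of_nat (m choose k) * (1 + (-1) ^ (m - k)) * of_int (euler_number k)) =
     (if m = 0 then 2 else (0 :: 'a :: comm_ring_1))"
proof -
  let ?f = "\<lambda>j. of_nat (m choose j) * (1 + (-1) ^ j) * (of_int (euler_number (m - j)) :: 'a)"
  have "(\<Sum>k\<le>m. of_nat (m choose k) * (1 + (-1) ^ (m - k)) * of_int (euler_number k)) = (\<Sum>j\<le>m. ?f j)"
    by (rule sum.reindex_bij_witness[of _ "\<lambda>j. m - j" "\<lambda>j. m - j"])
       (auto simp: binomial_symmetric[symmetric])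
  also have "\<dots> = (\<Sum>j\<in>(\<lambda>i. 2 * i) ` {0..m div 2}. ?f j)"
  proof (rule sum.mono_neutral_right)
    show "\<forall>j\<in>{..m} - (\<lambda>i. 2 * i) ` {0..m div 2}. ?f j = 0"
    proof
      fix j assume j: "j \<in> {..m} - (\<lambda>i. 2 * i) ` {0..m div 2}"
      have "odd j"
      proof
        assume "even j"
        then obtain i where "j = 2 * i" by blast
        with j show False by auto
      qed
      then show "?f j = 0" by simp
    qed
  qed auto
  also have "\<dots> = (\<Sum>i=0..m div 2. ?f (2 * i))"
    by (subst sum.reindex) (auto simp: inj_on_def)
  also have "\<dots> = 2 * of_int (\<Sum>i=0..m div 2. int (m choose (2 * i)) * euler_number (m - 2 * i))"
    by (simp add: sum_distrib_left algebra_simps)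
  also have "(\<Sum>i=0..m div 2. int (m choose (2 * i)) * euler_number (m - 2 * i)) =
      euler_number m + (\<Sum>i=1..m div 2. int (m choose (2 * i)) * euler_number (m - 2 * i))"
    by (simp add: sum.atLeast_Suc_atMost)
  also have "\<dots> = (if m = 0 then 1 else 0)"
    by (subst euler_number.simps) auto
  finally show ?thesis by simp
qed

lemma sum_euler_number_shift:
  fixes z :: "'a :: comm_ring_1" and n :: nat
  defines "Q \<equiv> \<lambda>z. \<Sum>k\<le>n. of_nat (n choose k) * z ^ (n - k) * of_int (euler_number k)"
  shows "Q (z + 1) + Q (z - 1) = 2 * z ^ n"
proof -
  let ?g = "\<lambda>m k. of_nat (m choose k) * (1 + (-1) ^ (m - k)) * (of_int (euler_number k) :: 'a)"
  have "Q (z + 1) + Q (z - 1) =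
      (\<Sum>k\<le>n. \<Sum>j\<le>n - k. of_nat (n choose k) * of_nat ((n - k) choose j) * z ^ j *
         (1 + (-1) ^ (n - k - j)) * of_int (euler_number k))"
  proof -
    have *: "(z + 1) ^ m + (z - 1) ^ m = (\<Sum>j\<le>m. of_nat (m choose j) * z ^ j * (1 + (-1) ^ (m - j)))" for m
      using binomial_ring[of z 1 m] binomial_ring[of z "-1" m]
      by (simp add: sum.distrib[symmetric] algebra_simps)
    have "of_nat (n choose k) * (z + 1) ^ (n - k) * of_int (euler_number k)
        + of_nat (n choose k) * (z - 1) ^ (n - k) * of_int (euler_number k) =
        of_nat (n choose k) * of_int (euler_number k) *
          (\<Sum>j\<le>n - k. of_nat ((n - k) choose j) * z ^ j * (1 + (-1) ^ (n - k - j)))" for k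
      unfolding *[symmetric] by (simp add: algebra_simps)
    then have "Q (z + 1) + Q (z - 1) = (\<Sum>k\<le>n. of_nat (n choose k) * of_int (euler_number k) *
        (\<Sum>j\<le>n - k. of_nat ((n - k) choose j) * z ^ j * (1 + (-1) ^ (n - k - j))))"
      unfolding Q_def sum.distrib[symmetric] by simp
    then show ?thesis
      by (simp only: sum_distrib_left mult_ac)
  qed
  also have "\<dots> = (\<Sum>j\<le>n. \<Sum>k\<le>n - j. of_nat (n choose k) * of_nat ((n - k) choose j) * z ^ j *
         (1 + (-1) ^ (n - k - j)) * of_int (euler_number k))"
    unfolding sum.Sigma[OF finite_atMost ballI[OF finite_atMost]]
    by (rule sum.reindex_bij_witness[of _ prod.swap prod.swap]) auto
  also have "\<dots> = (\<Sum>j\<le>n. of_nat (n choose j) * z ^ j * (\<Sum>k\<le>n - j. ?g (n - j) k))"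
  proof (intro sum.cong refl, unfold sum_distrib_left, intro sum.cong refl)
    fix j k assume "j \<in> {..n}" "k \<in> {..n - j}"
    then have le: "j + k \<le> n" by auto
    have "(n choose k) * ((n - k) choose j) = (n choose j) * ((n - j) choose k)"
      using choose_mult[of k "j + k" n] choose_mult[of j "j + k" n] le
      by (simp add: binomial_symmetric[of j "j + k"])
    then have "(of_nat (n choose k) * of_nat ((n - k) choose j) :: 'a) =
        of_nat (n choose j) * of_nat ((n - j) choose k)"
      by (metis of_nat_mult)
    then show "of_nat (n choose k) * of_nat ((n - k) choose j) * z ^ j *
         (1 + (-1) ^ (n - k - j)) * of_int (euler_number k) =
         of_nat (n choose j) * z ^ j * ?g (n - j) k"
      by (simp add: mult_ac add.commute)
  qed
  also have "\<dots> = (\<Sum>j\<le>n. if j = n then 2 * z ^ n else 0)"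
    by (subst sum_euler_number_even) (intro sum.cong, auto)
  finally show ?thesis by simp
qed

lemma euler_poly_shift: "euler_poly n x + euler_poly n (x + 1) = 2 * x ^ n"
  using sum_euler_number_shift[of n "2 * x"]
  by (simp add: euler_poly_def field_simps)

lemma euler_poly_0:
  assumes "even n" "n > 0"
  shows "euler_poly n 0 = 0"
proof -
  have "(2 * 1 - 1) ^ (n - k) * rat_of_int (euler_number k) =
      (2 * 0 - 1) ^ (n - k) * of_int (euler_number k)" for k
    using assms by (cases "even k") (simp_all add: euler_number_odd minus_one_power_iff)
  then have "euler_poly n 1 = euler_poly n 0"
    unfolding euler_poly_def by (simp only: mult.assoc)
  then show ?thesis
    using euler_poly_shift[of n 0] assms by simp
qed

section \<open>Sums of products of binomial coefficients\<close>

definition binsum :: "nat \<Rightarrow> rat \<Rightarrow> rat" where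
  "binsum n a = (\<Sum>k\<le>n. (a gchoose k) * ((-1 - a) gchoose k))"

lemma gchoose_prod_Suc:
  fixes a :: "'a :: field_char_0"
  shows "of_nat (Suc k) ^ 2 * ((a gchoose Suc k) * ((-1 - a) gchoose Suc k)) =
    (of_nat k - a) * (of_nat k + 1 + a) * ((a gchoose k) * ((-1 - a) gchoose k))"
proof -
  have *: "of_nat (Suc k) * (b gchoose Suc k) = (b - of_nat k) * (b gchoose k)" for b :: 'a
    by (metis gbinomial_absorb_comp gbinomial_absorption)
  have "of_nat (Suc k) ^ 2 * ((a gchoose Suc k) * ((-1 - a) gchoose Suc k)) =
      (of_nat (Suc k) * (a gchoose Suc k)) * (of_nat (Suc k) * ((-1 - a) gchoose Suc k))"
    by (simp only: power2_eq_square mult_ac)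
  also have "\<dots> = (of_nat k - a) * (of_nat k + 1 + a) * ((a gchoose k) * ((-1 - a) gchoose k))"
    unfolding * by (simp add: algebra_simps)
  finally show ?thesis .
qed

lemma weighted_sum_gchoose_prod:
  "(\<Sum>k\<le>n. of_nat k * (a gchoose k) * ((-1 - a) gchoose k)) =
     a * (a + 1) * binsum n a + of_nat (Suc n) ^ 2 * ((a gchoose Suc n) * ((-1 - a) gchoose Suc n))"
proof (induction n)
  case 0
  then show ?case by (simp add: binsum_def algebra_simps)
next
  case (Suc n)
  show ?case
    unfolding sum.atMost_Suc Suc.IH gchoose_prod_Suc[of "Suc n"]
    by (simp add: binsum_def algebra_simps power2_eq_square)
qed

lemma binsum_add_binsum_pred:
  "binsum n a + binsum n (a - 1) = 2 * ((a - 1) gchoose n) * ((-a - 1) gchoose n)"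
proof (induction n)
  case 0
  then show ?case by (simp add: binsum_def)
next
  case (Suc n)
  define x where "x = (a - 1) gchoose n"
  define y where "y = (-a - 1) gchoose n"
  define c :: rat where "c = of_nat (Suc n)"
  have c: "c \<noteq> 0" unfolding c_def by simp
  have 1: "(b gchoose Suc n) = (b - of_nat n) * (b gchoose n) / of_nat (Suc n)" for b :: rat
    by (metis gbinomial_absorb_comp gbinomial_absorption nonzero_mult_div_cancel_left of_nat_neq_0)
  have 2: "(b gchoose Suc n) = b * ((b - 1) gchoose n) / of_nat (Suc n)" for b :: rat
    by (metis gbinomial_absorption nonzero_mult_div_cancel_left of_nat_neq_0)
  have n: "of_nat n = c - 1" "of_nat (Suc n) = c" by (simp_all add: c_def)
  have e: "(a - 1) gchoose Suc n = (a - c) * x / c" "(-a - 1) gchoose Suc n = (-a - c) * y / c"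
    "a gchoose Suc n = a * x / c" "(-a) gchoose Suc n = -a * y / c"
    using 1[of "a - 1"] 1[of "-a - 1"] 2[of a] 2[of "-a"]
    unfolding n by (simp_all add: x_def y_def algebra_simps)
  have "binsum (Suc n) a + binsum (Suc n) (a - 1) =
      2 * x * y + ((a gchoose Suc n) * ((-a - 1) gchoose Suc n)
        + ((a - 1) gchoose Suc n) * ((-a) gchoose Suc n))"
  proof -
    have neg: "-1 - a = - a - 1" "-1 - (a - 1) = - a" by simp_all
    show ?thesis
      using Suc.IH unfolding binsum_def x_def y_def neg by (simp add: mult_ac)
  qed
  also have "\<dots> = 2 * ((a - 1) gchoose Suc n) * ((-a - 1) gchoose Suc n)"
    unfolding e using c by (simp add: field_simps)
  finally show ?case .
qed

section \<open>Congruences of \<open>p\<close>-integral rationals\<close>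

context
  fixes p :: nat
  assumes p: "prime p"
begin

lemma Zp_of_int [simp]: "of_int n \<in> Zp p"
  unfolding Zp_iff[OF p] using p
  by (intro exI[of _ n] exI[of _ 1]) (auto simp: not_prime_unit)

lemma Zp_of_nat [simp]: "of_nat n \<in> Zp p"
  using Zp_of_int[of "int n"] by simp

lemma Zp_0 [simp]: "0 \<in> Zp p" and Zp_1 [simp]: "1 \<in> Zp p"
  and Zp_numeral [simp]: "numeral k \<in> Zp p"
  using Zp_of_nat[of 0] Zp_of_nat[of 1] Zp_of_nat[of "numeral k"] by simp_all

lemma Zp_mult [simp]:
  assumes "x \<in> Zp p" "y \<in> Zp p"
  shows "x * y \<in> Zp p"
proof -
  obtain n d n' d' where "\<not> int p dvd d" "\<not> int p dvd d'"
    "x = of_int n / of_int d" "y = of_int n' / of_int d'"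
    using assms unfolding Zp_iff[OF p] by blast
  then show ?thesis
    unfolding Zp_iff[OF p] using p
    by (intro exI[of _ "n * n'"] exI[of _ "d * d'"]) (auto simp: prime_dvd_mult_iff)
qed

lemma Zp_add [simp]:
  assumes "x \<in> Zp p" "y \<in> Zp p"
  shows "x + y \<in> Zp p"
proof -
  obtain n d n' d' where *: "\<not> int p dvd d" "\<not> int p dvd d'"
    "x = of_int n / of_int d" "y = of_int n' / of_int d'"
    using assms unfolding Zp_iff[OF p] by blast
  then have "d \<noteq> 0" "d' \<noteq> 0" by auto
  then show ?thesis
    unfolding Zp_iff[OF p] using p *
    by (intro exI[of _ "n * d' + n' * d"] exI[of _ "d * d'"])
       (auto simp: prime_dvd_mult_iff field_simps)
qed

lemma Zp_uminus [simp]: "x \<in> Zp p \<Longrightarrow> - x \<in> Zp p"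
  using Zp_mult[OF Zp_of_int[of "-1"], of x] by simp

lemma Zp_diff [simp]: "x \<in> Zp p \<Longrightarrow> y \<in> Zp p \<Longrightarrow> x - y \<in> Zp p"
  using Zp_add[of x "-y"] by simp

lemma Zp_power [simp]: "x \<in> Zp p \<Longrightarrow> x ^ n \<in> Zp p"
  by (induction n) simp_all

lemma Zp_sum: "(\<And>i. i \<in> A \<Longrightarrow> f i \<in> Zp p) \<Longrightarrow> sum f A \<in> Zp p"
  by (induction A rule: infinite_finite_induct) simp_all

lemma Zp_prod: "(\<And>i. i \<in> A \<Longrightarrow> f i \<in> Zp p) \<Longrightarrow> prod f A \<in> Zp p"
  by (induction A rule: infinite_finite_induct) simp_all

lemma Zp_inverse_of_nat:
  assumes "\<not> p dvd k"
  shows "inverse (of_nat k) \<in> Zp p"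
  unfolding Zp_iff[OF p] using assms
  by (intro exI[of _ 1] exI[of _ "int k"]) (auto simp: field_simps)

lemma rat_cong_iff: "rat_cong p m x y \<longleftrightarrow> (\<exists>z\<in>Zp p. x = y + of_nat p ^ m * z)"
proof -
  have "of_nat p ^ m \<noteq> (0 :: rat)" using p by (auto simp: prime_gt_0_nat)
  then show ?thesis
    unfolding rat_cong_def
    by (auto simp: field_simps intro!: bexI[of _ "(x - y) / of_nat p ^ m"])
qed

lemma rat_congI: "z \<in> Zp p \<Longrightarrow> x = y + of_nat p ^ m * z \<Longrightarrow> rat_cong p m x y"
  unfolding rat_cong_iff by blast

lemma rat_congE:
  assumes "rat_cong p m x y"
  obtains z where "z \<in> Zp p" "x = y + of_nat p ^ m * z"
  using assms unfolding rat_cong_iff by blast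

lemma rat_cong_refl [simp]: "rat_cong p m x x"
  by (rule rat_congI[of 0]) simp_all

lemma rat_cong_sym:
  assumes "rat_cong p m x y"
  shows "rat_cong p m y x"
  using assms by (elim rat_congE) (rule rat_congI[of "- _"], auto)

lemma rat_cong_add:
  assumes "rat_cong p m x y" "rat_cong p m x' y'"
  shows "rat_cong p m (x + x') (y + y')"
proof -
  obtain z z' where "z \<in> Zp p" "x = y + of_nat p ^ m * z" "z' \<in> Zp p" "x' = y' + of_nat p ^ m * z'"
    using assms by (elim rat_congE)
  then show ?thesis by (intro rat_congI[of "z + z'"]) (auto simp: algebra_simps)
qed

lemma rat_cong_uminus:
  assumes "rat_cong p m x y"
  shows "rat_cong p m (- x) (- y)"
  using assms by (elim rat_congE) (rule rat_congI[of "- _"], auto)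

lemma rat_cong_trans [trans]:
  assumes "rat_cong p m x y" "rat_cong p m y z"
  shows "rat_cong p m x z"
  using rat_cong_add[OF assms] rat_cong_add[OF _ rat_cong_refl, of m "x + y" "y + z" "-y"] by simp

lemma rat_cong_mult:
  assumes "rat_cong p m x y" "rat_cong p m x' y'" "y \<in> Zp p" "y' \<in> Zp p"
  shows "rat_cong p m (x * x') (y * y')"
proof -
  obtain z z' where "z \<in> Zp p" "x = y + of_nat p ^ m * z" "z' \<in> Zp p" "x' = y' + of_nat p ^ m * z'"
    using assms by (elim rat_congE)
  then show ?thesis using assms(3,4)
    by (intro rat_congI[of "y * z' + z * y' + of_nat p ^ m * z * z'"]) (auto simp: algebra_simps)
qed

lemma rat_cong_power:
  assumes "rat_cong p m x y" "y \<in> Zp p"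
  shows "rat_cong p m (x ^ n) (y ^ n)"
  using assms by (induction n) (auto intro!: rat_cong_mult)

lemma rat_cong_sum:
  "(\<And>i. i \<in> A \<Longrightarrow> rat_cong p m (f i) (g i)) \<Longrightarrow> rat_cong p m (sum f A) (sum g A)"
  by (induction A rule: infinite_finite_induct) (auto intro: rat_cong_add)

lemma rat_cong_prod:
  "(\<And>i. i \<in> A \<Longrightarrow> rat_cong p m (f i) (g i)) \<Longrightarrow> (\<And>i. i \<in> A \<Longrightarrow> g i \<in> Zp p) \<Longrightarrow>
     rat_cong p m (prod f A) (prod g A)"
  by (induction A rule: infinite_finite_induct) (auto intro!: rat_cong_mult Zp_prod)

lemma rat_cong_scale:
  assumes "rat_cong p m x y"
  shows "rat_cong p (n + m) (of_nat p ^ n * x) (of_nat p ^ n * y)"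
  using assms by (elim rat_congE) (auto simp: algebra_simps power_add intro!: rat_congI)

lemma rat_cong_of_int:
  assumes "[n = k] (mod int p)"
  shows "rat_cong p 1 (of_int n) (of_int k)"
proof -
  obtain z where "n = k + int p * z"
    using assms by (metis cong_iff_lin cong_sym)
  then show ?thesis by (intro rat_congI[of "of_int z"]) auto
qed

lemma rat_cong_of_nat_p_mult:
  assumes "t \<in> Zp p"
  shows "rat_cong p 1 (x + of_nat p * t) x"
  using assms by (intro rat_congI[of t]) auto

lemma Zp_inverse:
  assumes "a \<in> Zp p" "\<not> rat_cong p 1 a 0"
  shows "inverse a \<in> Zp p"
proof -
  obtain n d where nd: "\<not> int p dvd d" "a = of_int n / of_int d"
    using assms(1) unfolding Zp_iff[OF p] by blast
  then have "\<not> int p dvd n"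
    using Zp_div_iff[OF p, of d n] assms(2) by (simp add: rat_cong_def)
  then show ?thesis
    unfolding Zp_iff[OF p] using nd by (intro exI[of _ d] exI[of _ n]) auto
qed

lemma not_rat_cong_of_nat_0:
  assumes "\<not> p dvd r"
  shows "\<not> rat_cong p 1 (of_nat r) 0"
  using Zp_div_iff[OF p, of 1 "int r"] assms prime_gt_1_nat[OF p] by (simp add: rat_cong_def)

lemma rat_fermat:
  assumes "a \<in> Zp p" "\<not> rat_cong p 1 a 0"
  shows "rat_cong p 1 (a ^ (p - 1)) 1"
proof -
  obtain r where r: "r < p" "rat_cong p 1 a (of_nat r)"
    using residue_ex1[OF p assms(1)] by blast
  have "r \<noteq> 0" using r assms by (intro notI) simp
  then have "\<not> p dvd r" using r by (meson nat_dvd_not_less not_gr_zero)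
  then have "[r ^ (p - 1) = 1] (mod p)" by (rule fermat_theorem[OF p])
  then have "[int r ^ (p - 1) = 1] (mod int p)"
    by (metis cong_int_iff of_nat_1 of_nat_power)
  from rat_cong_of_int[OF this] have "rat_cong p 1 (of_nat r ^ (p - 1)) 1" by simp
  with rat_cong_power[OF r(2), of "p - 1"] show ?thesis
    using rat_cong_trans by simp
qed

lemma inverse_square_cong:
  assumes "a \<in> Zp p" "\<not> rat_cong p 1 a 0" "p > 3"
  shows "rat_cong p 1 (a ^ (p - 3)) (inverse a ^ 2)"
proof -
  have a0: "a \<noteq> 0" using assms by auto
  have "rat_cong p 1 (a ^ (p - 1) * inverse a ^ 2) (1 * inverse a ^ 2)"
    using assms by (intro rat_cong_mult rat_fermat rat_cong_refl Zp_power Zp_inverse Zp_1)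
  moreover have "p - 1 = (p - 3) + 2" using assms by simp
  moreover have "a ^ (p - 3 + 2) * inverse a ^ 2 = a ^ (p - 3)"
    using a0 by (simp add: power_add power2_eq_square field_simps)
  ultimately show ?thesis by (metis mult_1)
qed

lemma power_sum_dvd:
  assumes "m + 1 < p"
  shows "p dvd (\<Sum>k<p. k ^ m)"
  using assms
proof (induction m rule: less_induct)
  case (less m)
  have "n ^ Suc m = (\<Sum>j\<le>m. (Suc m choose j) * (\<Sum>k<n. k ^ j))" for n :: nat
  proof (induction n)
    case (Suc n)
    have "Suc n ^ Suc m = n ^ Suc m + (\<Sum>j\<le>m. (Suc m choose j) * n ^ j)"
      using binomial[of n 1 "Suc m"] by simp
    then show ?case
      unfolding Suc.IH by (simp add: sum.distrib algebra_simps)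
  qed simp
  from this[of p] have "p ^ Suc m =
      (\<Sum>j<m. (Suc m choose j) * (\<Sum>k<p. k ^ j)) + Suc m * (\<Sum>k<p. k ^ m)"
    by (simp add: lessThan_Suc_atMost[symmetric])
  moreover have "p dvd (\<Sum>j<m. (Suc m choose j) * (\<Sum>k<p. k ^ j))"
    using less.prems by (intro dvd_sum, intro dvd_mult less.IH) auto
  moreover have "p dvd p ^ Suc m" by simp
  ultimately have "p dvd Suc m * (\<Sum>k<p. k ^ m)"
    by (simp only: dvd_add_right_iff)
  moreover have "\<not> p dvd Suc m" using less.prems by (auto dest: dvd_imp_le)
  ultimately show ?case using p prime_dvd_mult_iff by blast
qed

lemma sum_inverse_square:
  assumes "p > 3"
  shows "rat_cong p 1 (\<Sum>k=1..<p. inverse (of_nat k) ^ 2) 0"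
proof -
  have "rat_cong p 1 (\<Sum>k=1..<p. inverse (of_nat k) ^ 2) (\<Sum>k=1..<p. of_nat k ^ (p - 3))"
    using assms
    by (intro rat_cong_sum rat_cong_sym[OF inverse_square_cong] not_rat_cong_of_nat_0)
       (auto dest: dvd_imp_le)
  also have "(\<Sum>k=1..<p. of_nat k ^ (p - 3)) = (of_int (int (\<Sum>k<p. k ^ (p - 3))) :: rat)"
    using assms by (simp add: lessThan_atLeast0 sum.atLeast_Suc_lessThan)
  also have "rat_cong p 1 \<dots> (of_int 0)"
  proof (rule rat_cong_of_int)
    have "p dvd (\<Sum>k<p. k ^ (p - 3))" using assms by (intro power_sum_dvd) auto
    then show "[int (\<Sum>k<p. k ^ (p - 3)) = 0] (mod int p)"
      by (metis cong_0_iff int_dvd_int_iff)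
  qed
  finally show ?thesis by simp
qed

lemma wolstenholme:
  assumes "p > 3"
  shows "rat_cong p 2 (\<Sum>k=1..<p. inverse (of_nat k)) 0"
proof -
  define H :: rat where "H = (\<Sum>k=1..<p. inverse (of_nat k))"
  have inv: "inverse (of_nat k) \<in> Zp p" if "k \<in> {1..<p}" for k
    using that by (intro Zp_inverse_of_nat) (auto dest: dvd_imp_le)
  have "H = (\<Sum>k=1..<p. inverse (of_nat (p - k)))"
    unfolding H_def by (rule sum.reindex_bij_witness[of _ "\<lambda>k. p - k" "\<lambda>k. p - k"]) auto
  then have "2 * H = (\<Sum>k=1..<p. inverse (of_nat k) + inverse (of_nat (p - k)))"
    by (simp add: sum.distrib H_def)
  also have "\<dots> = (\<Sum>k=1..<p. of_nat p * (inverse (of_nat k) * inverse (of_nat (p - k))))"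
    by (intro sum.cong refl) (auto simp: field_simps of_nat_diff)
  finally have H: "2 * H = of_nat p * (\<Sum>k=1..<p. inverse (of_nat k) * inverse (of_nat (p - k)))"
    by (simp add: sum_distrib_left)
  have "rat_cong p 1 (\<Sum>k=1..<p. inverse (of_nat k) * inverse (of_nat (p - k)))
      (\<Sum>k=1..<p. - (inverse (of_nat k) ^ 2))"
  proof (rule rat_cong_sum)
    fix k assume k: "k \<in> {1..<p}"
    then have "p - k \<in> {1..<p}" by auto
    with k have Zp: "inverse (of_nat k) ^ 2 * inverse (of_nat (p - k)) \<in> Zp p"
      by (intro Zp_mult Zp_power inv)
    have "i * j = - (i ^ 2) + P ^ 1 * (i ^ 2 * j)" if "K * i = 1" "(P - K) * j = 1" for i j K P :: rat
    proof -
      have "i * j = (K * i) * (i * j)" "i ^ 2 = i ^ 2 * ((P - K) * j)"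
        using that by simp_all
      moreover have "(K * i) * (i * j) = - (i ^ 2 * ((P - K) * j)) + P ^ 1 * (i ^ 2 * j)"
        by (simp add: algebra_simps power2_eq_square)
      ultimately show ?thesis by argo
    qed
    moreover have "of_nat k * inverse (of_nat k) = (1 :: rat)"
      "(of_nat p - of_nat k) * inverse (of_nat (p - k)) = (1 :: rat)"
      using k by (auto simp: of_nat_diff)
    ultimately have "inverse (of_nat k) * inverse (of_nat (p - k)) = - (inverse (of_nat k) ^ 2) +
        rat_of_nat p ^ 1 * (inverse (of_nat k) ^ 2 * inverse (of_nat (p - k)))"
      by blast
    then show "rat_cong p 1 (inverse (of_nat k) * inverse (of_nat (p - k))) (- (inverse (of_nat k) ^ 2))"
      by (rule rat_congI[OF Zp])
  qed
  also have "rat_cong p 1 \<dots> (- 0)"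
    unfolding sum_negf by (intro rat_cong_uminus sum_inverse_square assms)
  finally have "rat_cong p (1 + 1) (2 * H) (of_nat p ^ 1 * (- 0))"
    unfolding H power_one_right by (intro rat_cong_scale[where n = 1, unfolded power_one_right])
  then have "rat_cong p 2 (2 * H) 0" by (simp add: numeral_2_eq_2)
  then obtain z where z: "z \<in> Zp p" "2 * H = of_nat p ^ 2 * z" by (elim rat_congE) auto
  have "inverse (of_nat 2) \<in> Zp p"
    using assms by (intro Zp_inverse_of_nat) (auto dest: dvd_imp_le)
  then show ?thesis
    unfolding H_def[symmetric] using z(2)
    by (intro rat_congI[OF Zp_mult[OF z(1)], of "inverse (of_nat 2)"]) auto
qed

section \<open>Binomial coefficients modulo \<open>p\<close>\<close>

lemma inverse_fact_Zp: "n < p \<Longrightarrow> inverse (fact n) \<in> Zp p"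
proof -
  assume "n < p"
  then have "\<not> p dvd fact n" using p by (simp add: prime_dvd_fact_iff)
  from Zp_inverse_of_nat[OF this] show ?thesis by simp
qed

lemma gchoose_pred_cong_0:
  assumes "t \<in> Zp p" "r < n" "n < p"
  shows "rat_cong p 1 ((of_nat r + of_nat p * t) gchoose n) 0"
proof -
  define a where "a = of_nat r + of_nat p * t"
  have a: "a \<in> Zp p" unfolding a_def using assms by simp
  have "(\<Prod>i=0..<n. a - of_nat i) = (a - of_nat r) * (\<Prod>i\<in>{0..<n} - {r}. a - of_nat i)"
    using assms by (intro prod.remove) auto
  then have "a gchoose n = of_nat p * (t * (\<Prod>i\<in>{0..<n} - {r}. a - of_nat i) * inverse (fact n))"
    by (simp add: gbinomial_prod_rev a_def field_simps)
  moreover have "(\<Prod>i\<in>{0..<n} - {r}. a - of_nat i) \<in> Zp p"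
    using a by (intro Zp_prod) simp
  ultimately show ?thesis
    unfolding a_def[symmetric] using inverse_fact_Zp assms
    by (intro rat_congI[of "t * (\<Prod>i\<in>{0..<n} - {r}. a - of_nat i) * inverse (fact n)"]) auto
qed

lemma gchoose_p_cong:
  assumes "t \<in> Zp p" "r < p" "odd p"
  shows "rat_cong p 1 ((of_nat r + of_nat p * t) gchoose p) t"
  using assms(2)
proof (induction r)
  case 0
  have p0: "p > 0" using p prime_gt_0_nat by blast
  have "of_nat p * ((of_nat p * t) gchoose p) = of_nat p * (t * ((of_nat p * t - 1) gchoose (p - 1)))"
    using gbinomial_absorption[of "p - 1" "of_nat p * t"] p0 by (simp add: mult.assoc)
  then have "(of_nat p * t) gchoose p = t * ((of_nat p * t - 1) gchoose (p - 1))"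
    using p0 by simp
  also have "(of_nat p * t - 1) gchoose (p - 1) =
      (\<Prod>i=0..<p - 1. -1 + of_nat p * (t * inverse (of_nat (Suc i))))"
    unfolding gbinomial_prod_rev fact_prod_Suc of_nat_prod prod_dividef[symmetric]
    by (intro prod.cong refl) (auto simp: field_simps simp del: of_nat_Suc)
  finally have eq: "(of_nat p * t) gchoose p = t * \<dots>" .
  have "rat_cong p 1 (\<Prod>i=0..<p - 1. -1 + of_nat p * (t * inverse (of_nat (Suc i)))) (\<Prod>i=0..<p - 1. -1)"
    using assms
    by (intro rat_cong_prod rat_cong_of_nat_p_mult Zp_mult Zp_inverse_of_nat) (auto dest: dvd_imp_le)
  then have "rat_cong p 1 (\<Prod>i=0..<p - 1. -1 + of_nat p * (t * inverse (of_nat (Suc i)))) 1"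
    using assms by simp
  then have "rat_cong p 1 ((of_nat p * t) gchoose p) (t * 1)"
    unfolding eq using assms by (intro rat_cong_mult) auto
  then show ?case by simp
next
  case (Suc r)
  have "(of_nat (Suc r) + of_nat p * t) gchoose p =
      ((of_nat r + of_nat p * t) gchoose (p - 1)) + ((of_nat r + of_nat p * t) gchoose p)"
    using gbinomial_Suc_Suc[of "of_nat r + of_nat p * t" "p - 1"] Suc.prems by (simp add: algebra_simps)
  also have "rat_cong p 1 \<dots> (0 + t)"
    using Suc assms by (intro rat_cong_add gchoose_pred_cong_0) auto
  finally show ?case by simp
qed

section \<open>The unweighted sum modulo \<open>p\<^sup>3\<close>\<close>

lemma euler_poly_Zp:
  assumes "x \<in> Zp p" "odd p"
  shows "euler_poly n x \<in> Zp p"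
proof -
  have "\<not> p dvd 2 ^ n" using p assms by (metis prime_dvd_power primes_dvd_imp_eq two_is_prime_nat even_numeral)
  from Zp_inverse_of_nat[OF this] have "1 / 2 ^ n \<in> Zp p" by (simp add: field_simps)
  then show ?thesis
    unfolding euler_poly_def using assms by (intro Zp_mult Zp_sum) auto
qed

lemma euler_poly_cong:
  assumes "rat_cong p 1 x y" "y \<in> Zp p" "odd p"
  shows "rat_cong p 1 (euler_poly n x) (euler_poly n y)"
proof -
  have "\<not> p dvd 2 ^ n" using p assms by (metis prime_dvd_power primes_dvd_imp_eq two_is_prime_nat even_numeral)
  from Zp_inverse_of_nat[OF this] have "1 / 2 ^ n \<in> Zp p" by (simp add: field_simps)
  moreover have "rat_cong p 1 (2 * x - 1) (2 * y - 1)"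
    using rat_cong_add[OF rat_cong_mult[OF rat_cong_refl assms(1), of 2] rat_cong_refl, of "-1"] assms
    by simp
  ultimately show ?thesis
    unfolding euler_poly_def using assms
    by (intro rat_cong_mult rat_cong_refl rat_cong_sum rat_cong_power Zp_mult Zp_sum) auto
qed

lemma gchoose_prod_cong:
  assumes "t \<in> Zp p" "1 \<le> k" "k < p"
  shows "rat_cong p 3 (((of_nat p * t) gchoose k) * ((-1 - of_nat p * t) gchoose k))
    (- of_nat p * t * inverse (of_nat k) - of_nat p ^ 2 * t ^ 2 * inverse (of_nat k) ^ 2)"
  using assms(2,3)
proof (induction k rule: nat_induct_at_least)
  case base
  then show ?case by (simp add: algebra_simps power2_eq_square)
next
  case (Suc k)
  let ?u = "\<lambda>k. ((of_nat p * t) gchoose k) * ((-1 - of_nat p * t) gchoose k)"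
  define q i j where "q = of_nat p * t" and "i = (inverse (of_nat k) :: rat)"
    and "j = (inverse (of_nat (Suc k)) :: rat)"
  define K :: rat where "K = of_nat k"
  have K: "K * i = 1" "(K + 1) * j = 1" "of_nat k = K" "of_nat (Suc k) = K + 1"
    using Suc.hyps by (auto simp: K_def i_def j_def simp del: of_nat_Suc) (simp add: field_simps)
  have Zp: "i \<in> Zp p" "j \<in> Zp p" "K \<in> Zp p" "q \<in> Zp p"
    using Suc assms unfolding i_def j_def K_def q_def
    by (auto intro!: Zp_inverse_of_nat dest: dvd_imp_le simp del: of_nat_Suc)
  obtain z where z: "z \<in> Zp p" "?u k = - q * i - q ^ 2 * i ^ 2 + of_nat p ^ 3 * z"
    using Suc.IH Suc.prems by (auto simp: i_def q_def power_mult_distrib elim!: rat_congE)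
  have "(K + 1) ^ 2 * ?u (Suc k) = (K - q) * (K + 1 + q) * ?u k"
    using gchoose_prod_Suc[of k "of_nat p * t"] unfolding K q_def .
  moreover have "x = j ^ 2 * y" if "(K + 1) ^ 2 * x = y" for x y
  proof -
    have "j ^ 2 * y = ((K + 1) * j) ^ 2 * x"
      unfolding that[symmetric] by (simp only: power_mult_distrib mult_ac)
    then show ?thesis unfolding K(2) by simp
  qed
  ultimately have "?u (Suc k) = j ^ 2 * ((K - q) * (K + 1 + q) * ?u k)"
    by blast
  also have "\<dots> = - q * j - q ^ 2 * j ^ 2
      + (q ^ 3 * i ^ 2 * j ^ 2 * (K + 1 + q) + of_nat p ^ 3 * (j ^ 2 * (K - q) * (K + 1 + q) * z))"
  proof -
    have 1: "(K - q) * (q * i + q ^ 2 * i ^ 2) = q - q ^ 3 * i ^ 2"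
    proof -
      have "(K - q) * (q * i + q ^ 2 * i ^ 2) =
          q * (K * i) + q ^ 2 * i * (K * i) - q ^ 2 * i - q ^ 3 * i ^ 2"
        by (simp add: algebra_simps power2_eq_square power3_eq_cube)
      then show ?thesis unfolding K(1) by simp
    qed
    have 2: "j ^ 2 * (K + 1 + q) = j + q * j ^ 2"
    proof -
      have "j ^ 2 * (K + 1 + q) = j * ((K + 1) * j) + q * j ^ 2"
        by (simp add: algebra_simps power2_eq_square)
      then show ?thesis unfolding K(2) by simp
    qed
    have "j ^ 2 * ((K - q) * (K + 1 + q) * ?u k) =
        - (j ^ 2 * (K + 1 + q)) * ((K - q) * (q * i + q ^ 2 * i ^ 2))
        + of_nat p ^ 3 * (j ^ 2 * (K - q) * (K + 1 + q) * z)"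
      unfolding z(2) by (simp add: algebra_simps)
    also have "- (j ^ 2 * (K + 1 + q)) * ((K - q) * (q * i + q ^ 2 * i ^ 2)) =
        - q * (j ^ 2 * (K + 1 + q)) + q ^ 3 * i ^ 2 * j ^ 2 * (K + 1 + q)"
      unfolding 1 by (simp add: algebra_simps)
    also have "- q * (j ^ 2 * (K + 1 + q)) = - q * j - q ^ 2 * j ^ 2"
      unfolding 2 by (simp add: algebra_simps power2_eq_square)
    finally show ?thesis by (simp only: add.assoc)
  qed
  also have "\<dots> = - q * j - q ^ 2 * j ^ 2
      + of_nat p ^ 3 * (t ^ 3 * i ^ 2 * j ^ 2 * (K + 1 + q) + j ^ 2 * (K - q) * (K + 1 + q) * z)"
    by (simp add: q_def algebra_simps)
  finally show ?case
    using Zp z(1) assms(1)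
    by (intro rat_congI[of "t ^ 3 * i ^ 2 * j ^ 2 * (K + 1 + q) + j ^ 2 * (K - q) * (K + 1 + q) * z"])
       (auto simp: q_def j_def power_mult_distrib)
qed

lemma binsum_p_mult_cong:
  assumes "t \<in> Zp p" "p > 3"
  shows "rat_cong p 3 (binsum (p - 1) (of_nat p * t)) 1"
proof -
  let ?u = "\<lambda>k. ((of_nat p * t) gchoose k) * ((-1 - of_nat p * t) gchoose k)"
  have "binsum (p - 1) (of_nat p * t) = (\<Sum>k=0..<p. ?u k)"
    unfolding binsum_def using assms by (intro sum.cong) auto
  also have "\<dots> = 1 + (\<Sum>k=1..<p. ?u k)"
    using assms by (simp add: sum.atLeast_Suc_lessThan)
  also have "rat_cong p 3 \<dots> (1 + (\<Sum>k=1..<p.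
      - of_nat p * t * inverse (of_nat k) - of_nat p ^ 2 * t ^ 2 * inverse (of_nat k) ^ 2))"
    using assms by (intro rat_cong_add rat_cong_sum gchoose_prod_cong) auto
  also have "(\<Sum>k=1..<p. - of_nat p * t * inverse (of_nat k) - of_nat p ^ 2 * t ^ 2 * inverse (of_nat k) ^ 2) =
      - of_nat p * t * (\<Sum>k=1..<p. inverse (of_nat k))
      - of_nat p ^ 2 * t ^ 2 * (\<Sum>k=1..<p. inverse (of_nat k) ^ 2)"
    by (simp add: sum_subtractf sum_distrib_left sum_negf)
  also have "rat_cong p 3 (1 + \<dots>) 1"
  proof -
    obtain x where x: "x \<in> Zp p" "(\<Sum>k=1..<p. inverse (of_nat k)) = of_nat p ^ 2 * x"
      using wolstenholme[OF assms(2)] by (elim rat_congE) auto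
    obtain y where y: "y \<in> Zp p" "(\<Sum>k=1..<p. inverse (of_nat k) ^ 2) = of_nat p * y"
      using sum_inverse_square[OF assms(2)] by (elim rat_congE) auto
    show ?thesis
      unfolding x(2) y(2) using assms x(1) y(1)
      by (intro rat_congI[of "- t * x - t ^ 2 * y"])
         (auto simp: algebra_simps power2_eq_square power3_eq_cube)
  qed
  finally show ?thesis .
qed

lemma binsum_cong:
  assumes "t \<in> Zp p" "p > 3" "r < p" "a = of_nat r + of_nat p * t"
  shows "rat_cong p 3 (binsum (p - 1) a)
    ((-1) ^ r + of_nat p ^ 2 * (t * (t + 1) * euler_poly (p - 3) (- a)))"
  using assms(3,4)
proof (induction r arbitrary: a)
  case 0
  have odd: "odd p" using p assms prime_odd_nat by auto
  have "rat_cong p 1 (euler_poly (p - 3) (- a)) (euler_poly (p - 3) 0)"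
    using 0 assms odd
    by (intro euler_poly_cong) (auto intro!: rat_congI[of "- t"])
  also have "euler_poly (p - 3) 0 = 0"
    using odd assms by (intro euler_poly_0) auto
  finally have "rat_cong p 1 (t * (t + 1) * euler_poly (p - 3) (- a)) (t * (t + 1) * 0)"
    using assms by (intro rat_cong_mult) auto
  from rat_cong_scale[OF this, of 2]
  have "rat_cong p 3 (of_nat p ^ 2 * (t * (t + 1) * euler_poly (p - 3) (- a))) 0"
    by simp
  from rat_cong_add[OF binsum_p_mult_cong[OF assms(1,2)] rat_cong_sym[OF this]]
  show ?case using 0 by simp
next
  case (Suc r)
  let ?E = "\<lambda>x. euler_poly (p - 3) x"
  have odd: "odd p" using p assms prime_odd_nat by auto
  have a: "a \<in> Zp p" "\<not> rat_cong p 1 a 0"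
  proof -
    show "a \<in> Zp p" using Suc.prems assms by simp
    have "\<not> p dvd Suc r" using Suc.prems by (auto dest: dvd_imp_le)
    moreover have "rat_cong p 1 (of_nat (Suc r)) a"
      unfolding Suc.prems by (rule rat_cong_sym[OF rat_cong_of_nat_p_mult[OF assms(1)]])
    ultimately show "\<not> rat_cong p 1 a 0"
      using not_rat_cong_of_nat_0 rat_cong_trans[of 1 "of_nat (Suc r)" a 0] by blast
  qed
  have a0: "a \<noteq> 0" using a by auto
  have 1: "rat_cong p 1 (a gchoose p) t"
    unfolding Suc.prems using Suc.prems assms odd by (intro gchoose_p_cong)
  have 2: "rat_cong p 1 ((- a) gchoose p) (-1 - t)"
  proof -
    have eq: "- a = of_nat (p - Suc r) + of_nat p * (-1 - t)"
      using Suc.prems by (simp add: of_nat_diff algebra_simps)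
    show ?thesis
      unfolding eq using assms(1,2) odd by (intro gchoose_p_cong) auto
  qed
  have 3: "rat_cong p 1 (inverse a ^ 2) ((- a) ^ (p - 3))"
    using rat_cong_sym[OF inverse_square_cong[OF a assms(2)]] odd assms(2) by simp
  have "rat_cong p 1 (-2 * (inverse a ^ 2 * ((a gchoose p) * ((- a) gchoose p))))
      (-2 * ((- a) ^ (p - 3) * (t * (-1 - t))))"
    using a(1) assms(1)
    by (intro rat_cong_mult[OF rat_cong_refl] rat_cong_mult[OF 3] rat_cong_mult[OF 1 2]) auto
  from rat_cong_scale[OF this, of 2]
  have "rat_cong p 3 (of_nat p ^ 2 * (-2 * (inverse a ^ 2 * ((a gchoose p) * ((- a) gchoose p)))))
      (of_nat p ^ 2 * (-2 * ((- a) ^ (p - 3) * (t * (-1 - t)))))"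
    by simp
  also have "of_nat p ^ 2 * (-2 * (inverse a ^ 2 * ((a gchoose p) * ((- a) gchoose p)))) =
      binsum (p - 1) a + binsum (p - 1) (a - 1)"
  proof -
    have *: "of_nat p * (b gchoose p) = b * ((b - 1) gchoose (p - 1))" for b :: rat
      using gbinomial_absorption[of "p - 1" b] assms by simp
    have "of_nat p ^ 2 * (-2 * (inverse a ^ 2 * ((a gchoose p) * ((- a) gchoose p)))) =
        -2 * inverse a ^ 2 * ((of_nat p * (a gchoose p)) * (of_nat p * ((- a) gchoose p)))"
      by (simp add: power2_eq_square)
    also have "\<dots> = 2 * ((a - 1) gchoose (p - 1)) * ((- a - 1) gchoose (p - 1))"
      unfolding * using a0 by (simp add: power2_eq_square field_simps)
    finally show ?thesis unfolding binsum_add_binsum_pred .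
  qed
  finally have 4: "rat_cong p 3 (binsum (p - 1) a + binsum (p - 1) (a - 1))
      (of_nat p ^ 2 * (-2 * ((- a) ^ (p - 3) * (t * (-1 - t)))))" .
  have "rat_cong p 3 (binsum (p - 1) (a - 1))
      ((-1) ^ r + of_nat p ^ 2 * (t * (t + 1) * ?E (- (a - 1))))"
    using Suc.prems by (intro Suc.IH) auto
  from rat_cong_add[OF 4 rat_cong_uminus[OF this]]
  have "rat_cong p 3 (binsum (p - 1) a) (of_nat p ^ 2 * (-2 * ((- a) ^ (p - 3) * (t * (-1 - t))))
      - ((-1) ^ r + of_nat p ^ 2 * (t * (t + 1) * ?E (- (a - 1)))))"
    by (simp only: add_diff_cancel_right' diff_conv_add_uminus[symmetric])
  also have "?E (- (a - 1)) = 2 * (- a) ^ (p - 3) - ?E (- a)"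
    using euler_poly_shift[of "p - 3" "- a"] by (simp add: algebra_simps)
  finally show ?case by (simp add: algebra_simps)
qed

lemma weighted_sum_cong:
  assumes "t \<in> Zp p" "p > 3" "r < p" "a = of_nat r + of_nat p * t"
  shows "rat_cong p 3 (\<Sum>k = 0..p - 1. of_nat k * (a gchoose k) * ((-1 - a) gchoose k))
    ((-1) ^ r * a * (a + 1)
      + of_nat p ^ 2 * t * (t + 1) * (a * (a + 1) * euler_poly (p - 3) (- a) - 1))"
proof -
  have odd: "odd p" using p assms prime_odd_nat by auto
  have a: "a \<in> Zp p" using assms by simp
  have "rat_cong p 1 (a gchoose p) t"
    unfolding assms(4) using assms odd by (intro gchoose_p_cong)
  moreover have "rat_cong p 1 ((-1 - a) gchoose p) (-1 - t)"
  proof -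
    have eq: "-1 - a = of_nat (p - Suc r) + of_nat p * (-1 - t)"
      using assms by (simp add: of_nat_diff algebra_simps)
    show ?thesis
      unfolding eq using assms(1,2) odd by (intro gchoose_p_cong) auto
  qed
  ultimately have "rat_cong p 1 ((a gchoose p) * ((-1 - a) gchoose p)) (t * (-1 - t))"
    using assms by (intro rat_cong_mult) auto
  from rat_cong_scale[OF this, of 2]
  have 1: "rat_cong p 3 (of_nat p ^ 2 * ((a gchoose p) * ((-1 - a) gchoose p)))
      (of_nat p ^ 2 * (t * (-1 - t)))"
    by simp
  have 2: "rat_cong p 3 (a * (a + 1) * binsum (p - 1) a)
      (a * (a + 1) * ((-1) ^ r + of_nat p ^ 2 * (t * (t + 1) * euler_poly (p - 3) (- a))))"
    using a assms(1) odd euler_poly_Zp[of "- a" "p - 3"]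
    by (intro rat_cong_mult[OF rat_cong_refl binsum_cong[OF assms]]) auto
  have 3: "(\<Sum>k = 0..p - 1. of_nat k * (a gchoose k) * ((-1 - a) gchoose k)) =
      a * (a + 1) * binsum (p - 1) a + of_nat p ^ 2 * ((a gchoose p) * ((-1 - a) gchoose p))"
    using weighted_sum_gchoose_prod[of a "p - 1"] assms(2) by (simp add: atLeast0AtMost)
  from rat_cong_add[OF 2 1] show ?thesis
    unfolding 3 by (simp add: algebra_simps)
qed

end

theorem theorem2p2:
  fixes p :: nat and a t :: rat
  assumes "prime p" and "p > 3"
    and "a \<in> Zp p"
    and "\<not> rat_cong p 1 a 0" and "\<not> rat_cong p 1 a (-1)"
    and "t = (a - of_nat (residue p a)) / of_nat p"
  shows "rat_cong p 3
    (\<Sum>k = 0..p - 1. of_nat k * (a gchoose k) * ((-1 - a) gchoose k))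
    ((-1) ^ residue p a * a * (a + 1)
      + of_nat p ^ 2 * t * (t + 1) * (a * (a + 1) * euler_poly (p - 3) (- a) - 1))"
proof (rule weighted_sum_cong[OF assms(1) _ assms(2)])
  have "residue p a < p \<and> rat_cong p 1 a (of_nat (residue p a))"
    unfolding residue_def by (rule theI'[OF residue_ex1[OF assms(1,3)]])
  then show "residue p a < p" "t \<in> Zp p"
    by (simp_all add: assms(6) rat_cong_def)
  show "a = of_nat (residue p a) + of_nat p * t"
    using assms(2,6) by simp
qed

end
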